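(* Let $H$ be a Hopf algebra over $\mathbb{C}$, and let $V$ be an $H$-module vertex algebra such that the linear map $\pi_2^V:V\otimes V\to V((z))$, $u\otimes v\mapsto Y(u,z)v$, is injective. Let $K=\{h\in H\mid hV=0\}$ be the kernel of the action of $H$ on $V$. Then $K$ is a bialgebra ideal of $H$. In particular, if $H$ is finite-dimensional, then $K$ is a Hopf ideal of $H$.
   Context: All vector spaces and tensor products are over $\mathbb{C}$. A vertex algebra is a vector space $V$ with a vacuum vector $\mathbf{1}\in V$ and a linear map $Y(\cdot,z): V\to \mathrm{End}_{\mathbb{C}}(V)[[z,z^{-1}]]$, $v\mapsto Y(v,z)=\sum_{n\in\mathbb{Z}} v_n z^{-n-1}$, such that: for $u,v\in V$, $u_nv=0$ for $n$ sufficiently large; $Y(\mathbf{1},z)=\mathrm{Id}_V$; $Y(u,z)\mathbf{1}\in u+zV[[z]]$; and the Jacobi identity $$z_0^{-1}\delta\left(\tfrac{z_1-z_2}{z_0}\right)Y(u,z_1)Y(v,z_2)-z_0^{-1}\delta\left(\tfrac{z_2-z_1}{-z_0}\right)Y(v,z_2)Y(u,z_1)=z_2^{-1}\delta\left(\tfrac{z_1-z_0}{z_2}\right)Y(Y(u,z_0)v,z_2)$$ holds, where $\delta(z)=\sum_{n\in\mathbb{Z}}z^n$ and binomials are expanded in nonnegative integral powers of the second variable. Sweedler notation: $\Delta(h)=\sum h_1\otimes h_2$; $\epsilon$ is the counit, $S$ the antipode. $V$ is an $H$-module vertex algebra if $V$ is an $H$-module, $h\mathbf{1}=\epsilon(h)\mathbf{1}$,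 and $h(Y(u,z)v)=\sum Y(h_1u,z)h_2v$ for all $h\in H$, $u,v\in V$. A bialgebra ideal of $H$ is a two-sided ideal $I$ with $\Delta(I)\subseteq H\otimes I+I\otimes H$ and $\epsilon(I)=0$; it is a Hopf ideal if in addition $S(I)\subseteq I$.
   Formalization: V is assumed to be nonzero; for V = 0 the map π₂ is injective and K = H, but ε(1) = 1 ≠ 0, so K is not a bialgebra ideal and the statement fails. *)

theory Defs
  imports Complex_Main "HOL-Library.Poly_Mapping" "HOL-Computational_Algebra.Formal_Laurent_Series"
begin

section \<open>Complex vector spaces and algebras\<close>

class scaleC =
  fixes scaleC :: "complex \<Rightarrow> 'a \<Rightarrow> 'a" (infixr \<open>*\<^sub>C\<close> 75)

class complex_vector = scaleC + ab_group_add +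
  assumes scaleC_add_right: "a *\<^sub>C (x + y) = a *\<^sub>C x + a *\<^sub>C y"
    and scaleC_add_left: "(a + b) *\<^sub>C x = a *\<^sub>C x + b *\<^sub>C x"
    and scaleC_scaleC: "a *\<^sub>C b *\<^sub>C x = (a * b) *\<^sub>C x"
    and scaleC_one: "1 *\<^sub>C x = x"

class complex_algebra_1 = complex_vector + ring_1 +
  assumes mult_scaleC_left: "a *\<^sub>C x * y = a *\<^sub>C (x * y)"
    and mult_scaleC_right: "x * a *\<^sub>C y = a *\<^sub>C (x * y)"

global_interpretation complex_vector: vector_space "scaleC :: complex \<Rightarrow> 'a \<Rightarrow> 'a::complex_vector"
  by unfold_locales (rule scaleC_add_right scaleC_add_left scaleC_scaleC scaleC_one)+

abbreviation clinear :: "('a::complex_vector \<Rightarrow> 'b::complex_vector) \<Rightarrow> bool" where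
  "clinear \<equiv> Vector_Spaces.linear scaleC scaleC"

definition cbilinear :: "('a::complex_vector \<Rightarrow> 'b::complex_vector \<Rightarrow> 'c::complex_vector) \<Rightarrow> bool" where
  "cbilinear f \<longleftrightarrow> (\<forall>x. clinear (f x)) \<and> (\<forall>y. clinear (\<lambda>x. f x y))"

definition finite_dimensional :: "'a::complex_vector itself \<Rightarrow> bool" where
  "finite_dimensional _ \<longleftrightarrow> (\<exists>B::'a set. finite B \<and> complex_vector.span B = UNIV)"

lemma clinearI:
  assumes "\<And>x y. f (x + y) = f x + f y" "\<And>c x. f (c *\<^sub>C x) = c *\<^sub>C f x"
  shows "clinear f"
  by unfold_locales (rule assms)+

lemma clinear_add: "clinear f \<Longrightarrow> f (x + y) = f x + f y"
  by (rule module_hom.add[OF module_hom_linearI])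

lemma clinear_scale: "clinear f \<Longrightarrow> f (c *\<^sub>C x) = c *\<^sub>C f x"
  by (rule module_hom.scale[OF module_hom_linearI])

instantiation complex :: complex_algebra_1
begin
definition scaleC_complex :: "complex \<Rightarrow> complex \<Rightarrow> complex" where
  "scaleC_complex a x = a * x"
instance
  by standard (simp_all add: scaleC_complex_def algebra_simps)
end

instantiation poly_mapping :: (type, complex_vector) complex_vector
begin
lift_definition scaleC_poly_mapping :: "complex \<Rightarrow> ('a \<Rightarrow>\<^sub>0 'b) \<Rightarrow> ('a \<Rightarrow>\<^sub>0 'b)"
  is "\<lambda>c f x. c *\<^sub>C f x"
  by (erule finite_subset[rotated]) auto
instance
  by standard
    (transfer, simp add: fun_eq_iff scaleC_add_right scaleC_add_left scaleC_scaleC scaleC_one)+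
end

lemma fls_lower_bound: "\<exists>N. \<forall>n<N. fls_nth f n = 0"
  using fls_eq0_below_subdegree by blast

instantiation fls :: (complex_vector) complex_vector
begin
definition scaleC_fls :: "complex \<Rightarrow> 'a fls \<Rightarrow> 'a fls" where
  "scaleC_fls c f = Abs_fls (\<lambda>n. c *\<^sub>C fls_nth f n)"

lemma fls_nth_scaleC: "fls_nth (c *\<^sub>C f) n = c *\<^sub>C fls_nth f n" for f :: "'a fls"
proof -
  obtain N where "\<forall>n<N. fls_nth f n = 0"
    using fls_lower_bound by blast
  then show ?thesis
    unfolding scaleC_fls_def by (intro nth_Abs_fls_lower_bound[of N]) simp
qed

instance
  by standard
    (auto intro!: fls_eqI simp: fls_nth_scaleC scaleC_add_right scaleC_add_left scaleC_scaleC scaleC_one)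
end


section \<open>Tensor products over the complex numbers\<close>

text \<open>The tensor product of \<open>'a\<close> and \<open>'b\<close> is the free vector space on \<open>'a \<times> 'b\<close>
  modulo the span of the bilinearity relations.\<close>

definition tensor_relations :: "('a::complex_vector \<times> 'b::complex_vector \<Rightarrow>\<^sub>0 complex) set" where
  "tensor_relations = complex_vector.span
     ({Poly_Mapping.single (a + a', b) 1 - Poly_Mapping.single (a, b) 1
         - Poly_Mapping.single (a', b) 1 | a a' b. True} \<union>
      {Poly_Mapping.single (a, b + b') 1 - Poly_Mapping.single (a, b) 1
         - Poly_Mapping.single (a, b') 1 | a b b'. True} \<union>
      {Poly_Mapping.single (c *\<^sub>C a, b) 1 - c *\<^sub>C Poly_Mapping.single (a, b) 1 | c a b. True} \<union>
      {Poly_Mapping.single (a, c *\<^sub>C b) 1 - c *\<^sub>C Poly_Mapping.single (a, b) 1 | c a b. True})"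

lemma tensor_relations_add: "p \<in> tensor_relations \<Longrightarrow> q \<in> tensor_relations \<Longrightarrow> p + q \<in> tensor_relations"
  and tensor_relations_diff: "p \<in> tensor_relations \<Longrightarrow> q \<in> tensor_relations \<Longrightarrow> p - q \<in> tensor_relations"
  and tensor_relations_scale: "p \<in> tensor_relations \<Longrightarrow> c *\<^sub>C p \<in> tensor_relations"
  and tensor_relations_neg: "p \<in> tensor_relations \<Longrightarrow> - p \<in> tensor_relations"
  and tensor_relations_zero: "0 \<in> tensor_relations"
  unfolding tensor_relations_def
  by (auto intro: complex_vector.span_add complex_vector.span_diff complex_vector.span_scale
      complex_vector.span_neg complex_vector.span_zero)

quotient_type (overloaded) ('a, 'b) tensor =
  "'a::complex_vector \<times> 'b::complex_vector \<Rightarrow>\<^sub>0 complex" / "\<lambda>p q. p - q \<in> tensor_relations"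
proof (rule equivpI)
  show "reflp (\<lambda>p q::'a \<times> 'b \<Rightarrow>\<^sub>0 complex. p - q \<in> tensor_relations)"
    by (simp add: reflp_def tensor_relations_zero)
  show "symp (\<lambda>p q::'a \<times> 'b \<Rightarrow>\<^sub>0 complex. p - q \<in> tensor_relations)"
    by (rule sympI) (metis minus_diff_eq tensor_relations_neg)
  show "transp (\<lambda>p q::'a \<times> 'b \<Rightarrow>\<^sub>0 complex. p - q \<in> tensor_relations)"
    by (rule transpI, drule (1) tensor_relations_add) simp
qed

instantiation tensor :: (complex_vector, complex_vector) complex_vector
begin
lift_definition zero_tensor :: "('a, 'b) tensor" is 0 .
lift_definition plus_tensor :: "('a, 'b) tensor \<Rightarrow> ('a, 'b) tensor \<Rightarrow> ('a, 'b) tensor" is "(+)"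
  by (metis add_diff_add tensor_relations_add)
lift_definition uminus_tensor :: "('a, 'b) tensor \<Rightarrow> ('a, 'b) tensor" is uminus
  by (metis minus_diff_minus tensor_relations_neg)
lift_definition minus_tensor :: "('a, 'b) tensor \<Rightarrow> ('a, 'b) tensor \<Rightarrow> ('a, 'b) tensor" is "(-)"
proof -
  fix p p' q q' :: "'a \<times> 'b \<Rightarrow>\<^sub>0 complex"
  assume "p - p' \<in> tensor_relations" "q - q' \<in> tensor_relations"
  then have "(p - p') - (q - q') \<in> tensor_relations"
    by (rule tensor_relations_diff)
  then show "(p - q) - (p' - q') \<in> tensor_relations"
    by (simp add: algebra_simps)
qed
lift_definition scaleC_tensor :: "complex \<Rightarrow> ('a, 'b) tensor \<Rightarrow> ('a, 'b) tensor" is scaleC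
  by (metis complex_vector.scale_right_diff_distrib tensor_relations_scale)
instance
  by standard
    (transfer, simp add: tensor_relations_zero algebra_simps scaleC_add_right scaleC_add_left
       scaleC_scaleC scaleC_one)+
end

lift_definition tensor :: "'a::complex_vector \<Rightarrow> 'b::complex_vector \<Rightarrow> ('a, 'b) tensor"
    (infixl \<open>\<otimes>\<^sub>C\<close> 76)
  is "\<lambda>a b. Poly_Mapping.single (a, b) 1" .

definition free_lift ::
    "('a \<Rightarrow> 'b \<Rightarrow> 'c) \<Rightarrow> ('a \<times> 'b \<Rightarrow>\<^sub>0 complex) \<Rightarrow> 'c::complex_vector" where
  "free_lift f p = (\<Sum>(a, b)\<in>Poly_Mapping.keys p. Poly_Mapping.lookup p (a, b) *\<^sub>C f a b)"

text \<open>For bilinear \<open>f\<close> this is the linear map induced by \<open>f\<close> (see \<open>tensor_lift_unique\<close>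
  below); for other \<open>f\<close> it depends on the choice of representatives and has no meaning.\<close>

definition tensor_lift ::
    "('a \<Rightarrow> 'b \<Rightarrow> 'c) \<Rightarrow> ('a::complex_vector, 'b::complex_vector) tensor \<Rightarrow> 'c::complex_vector" where
  "tensor_lift f t = free_lift f (rep_tensor t)"

lemma free_lift_superset:
  assumes "finite A" "Poly_Mapping.keys p \<subseteq> A"
  shows "free_lift f p = (\<Sum>x\<in>A. Poly_Mapping.lookup p x *\<^sub>C f (fst x) (snd x))"
  unfolding free_lift_def split_def
  by (rule sum.mono_neutral_cong_left)
    (use assms in \<open>auto simp: not_in_keys_iff_lookup_eq_zero\<close>)

lemma free_lift_add: "free_lift f (p + q) = free_lift f p + free_lift f q"
proof -
  let ?A = "Poly_Mapping.keys p \<union> Poly_Mapping.keys q"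
  have "Poly_Mapping.keys (p + q) \<subseteq> ?A"
    by (rule Poly_Mapping.keys_add)
  then show ?thesis
    by (simp add: free_lift_superset[of ?A] lookup_add scaleC_add_left sum.distrib)
qed

lemma free_lift_scale: "free_lift f (c *\<^sub>C p) = c *\<^sub>C free_lift f p"
proof -
  have l: "Poly_Mapping.lookup (c *\<^sub>C p) x = c * Poly_Mapping.lookup p x" for x
    by transfer (simp add: scaleC_complex_def)
  have "Poly_Mapping.keys (c *\<^sub>C p) \<subseteq> Poly_Mapping.keys p"
    by (auto simp: in_keys_iff l)
  then show ?thesis
    by (simp add: free_lift_superset[of "Poly_Mapping.keys p"] l complex_vector.scale_sum_right
        scaleC_scaleC)
qed

lemma clinear_free_lift: "clinear (free_lift f)"
  by (rule clinearI) (simp_all add: free_lift_add free_lift_scale)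

lemma free_lift_diff: "free_lift f (p - q) = free_lift f p - free_lift f q"
  using free_lift_add[of f "p - q" q] by (simp add: algebra_simps)

lemma free_lift_single: "free_lift f (Poly_Mapping.single (a, b) 1) = f a b"
  by (simp add: free_lift_def scaleC_one)

lemma free_lift_relations:
  assumes f: "cbilinear f" and p: "p \<in> tensor_relations"
  shows "free_lift f p = 0"
  using p unfolding tensor_relations_def
proof (induction rule: complex_vector.span_induct_alt)
  case base
  then show ?case by (simp add: free_lift_def)
next
  case (step c x y)
  have f1: "clinear (f a)" and f2: "clinear (\<lambda>a. f a b)" for a b
    using f by (auto simp: cbilinear_def)
  have "free_lift f x = 0"
    using step(1)
    by (auto simp: free_lift_diff free_lift_scale free_lift_single
        clinear_add[OF f1] clinear_add[OF f2] clinear_scale[OF f1] clinear_scale[OF f2])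
  then show ?case
    using step by (simp add: free_lift_add free_lift_scale)
qed

lemma tensor_lift_abs:
  assumes "cbilinear f"
  shows "tensor_lift f (abs_tensor p) = free_lift f p"
proof -
  have "rep_tensor (abs_tensor p) - p \<in> tensor_relations"
    using Quotient3_rep_abs[OF Quotient3_tensor]
    by (simp add: tensor_relations_zero)
  then show ?thesis
    using free_lift_relations[OF assms] free_lift_diff unfolding tensor_lift_def
    by (metis eq_iff_diff_eq_0)
qed

lemma tensor_lift_tensor: "cbilinear f \<Longrightarrow> tensor_lift f (a \<otimes>\<^sub>C b) = f a b"
  by (simp add: tensor.abs_eq tensor_lift_abs free_lift_single)

lemma clinear_tensor_lift:
  fixes f :: "'a::complex_vector \<Rightarrow> 'b::complex_vector \<Rightarrow> 'c::complex_vector"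
  assumes "cbilinear f"
  shows "clinear (tensor_lift f)"
proof (rule clinearI)
  fix s t :: "('a, 'b) tensor" and c :: complex
  obtain p q where "s = abs_tensor p" "t = abs_tensor q"
    by (metis Quotient3_abs_rep[OF Quotient3_tensor])
  then show "tensor_lift f (s + t) = tensor_lift f s + tensor_lift f t"
    and "tensor_lift f (c *\<^sub>C s) = c *\<^sub>C tensor_lift f s"
    by (simp_all add: plus_tensor.abs_eq scaleC_tensor.abs_eq tensor_lift_abs[OF assms]
        free_lift_add free_lift_scale)
qed

lemma cbilinear_tensor: "cbilinear (\<otimes>\<^sub>C)"
proof -
  have 1: "(a + a') \<otimes>\<^sub>C b = a \<otimes>\<^sub>C b + a' \<otimes>\<^sub>C b" for a a' :: 'a and b :: 'b
    by transfer (unfold tensor_relations_def diff_diff_eq[symmetric],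
        rule complex_vector.span_base, blast)
  have 2: "a \<otimes>\<^sub>C (b + b') = a \<otimes>\<^sub>C b + a \<otimes>\<^sub>C b'" for a :: 'a and b b' :: 'b
    by transfer (unfold tensor_relations_def diff_diff_eq[symmetric],
        rule complex_vector.span_base, blast)
  have 3: "(c *\<^sub>C a) \<otimes>\<^sub>C b = c *\<^sub>C (a \<otimes>\<^sub>C b)" for c and a :: 'a and b :: 'b
    by transfer (unfold tensor_relations_def, rule complex_vector.span_base, blast)
  have 4: "a \<otimes>\<^sub>C (c *\<^sub>C b) = c *\<^sub>C (a \<otimes>\<^sub>C b)" for c and a :: 'a and b :: 'b
    by transfer (unfold tensor_relations_def, rule complex_vector.span_base, blast)
  show ?thesis
    unfolding cbilinear_def by (intro conjI allI clinearI) (rule 1 2 3 4)+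
qed

lemma tensor_induct [case_names tensor add]:
  assumes "\<And>a b. P (a \<otimes>\<^sub>C b)" "\<And>s t. P s \<Longrightarrow> P t \<Longrightarrow> P (s + t)"
  shows "P t"
proof -
  have single: "P (abs_tensor (Poly_Mapping.single x c))" for x c
  proof -
    have eq: "Poly_Mapping.single x c = c *\<^sub>C Poly_Mapping.single (fst x, snd x) 1"
      by (rule poly_mapping_eqI, transfer) (simp add: scaleC_complex_def when_def)
    have "abs_tensor (Poly_Mapping.single x c) = c *\<^sub>C (fst x \<otimes>\<^sub>C snd x)"
      unfolding eq scaleC_tensor.abs_eq[symmetric] tensor.abs_eq ..
    also have "\<dots> = fst x \<otimes>\<^sub>C (c *\<^sub>C snd x)"
      using cbilinear_tensor clinear_scale unfolding cbilinear_def by metis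
    finally show ?thesis
      using assms(1) by metis
  qed
  have "P (abs_tensor p)" for p
  proof (induction p rule: update_induct)
    case const
    then show ?case using single[of undefined 0] by simp
  next
    case (update p k v)
    have "Poly_Mapping.update k v p = Poly_Mapping.single k v + p"
      by (rule poly_mapping_eqI)
        (use update(1) in \<open>auto simp: lookup_update lookup_add lookup_single in_keys_iff when_def\<close>)
    then show ?case
      using update by (simp add: plus_tensor.abs_eq[symmetric] assms(2) single)
  qed
  then show ?thesis
    by (metis Quotient3_abs_rep[OF Quotient3_tensor])
qed

lemma tensor_lift_unique:
  assumes "cbilinear f" "clinear g" "\<And>a b. g (a \<otimes>\<^sub>C b) = f a b"
  shows "g = tensor_lift f"
proof
  fix t
  show "g t = tensor_lift f t"
    by (induction t rule: tensor_induct)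
      (simp_all add: assms tensor_lift_tensor clinear_add[OF assms(2)]
        clinear_add[OF clinear_tensor_lift[OF assms(1)]])
qed

definition map_tensor ::
    "('a \<Rightarrow> 'c) \<Rightarrow> ('b \<Rightarrow> 'd) \<Rightarrow> ('a::complex_vector, 'b::complex_vector) tensor
      \<Rightarrow> ('c::complex_vector, 'd::complex_vector) tensor" where
  "map_tensor f g = tensor_lift (\<lambda>a b. f a \<otimes>\<^sub>C g b)"

definition tensor_assoc ::
    "(('a::complex_vector, 'b::complex_vector) tensor, 'c::complex_vector) tensor
      \<Rightarrow> ('a, ('b, 'c) tensor) tensor" where
  "tensor_assoc = tensor_lift (\<lambda>s c. tensor_lift (\<lambda>a b. a \<otimes>\<^sub>C (b \<otimes>\<^sub>C c)) s)"

definition tensor_mult ::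
    "('a::complex_algebra_1, 'b::complex_algebra_1) tensor \<Rightarrow> ('a, 'b) tensor \<Rightarrow> ('a, 'b) tensor" where
  "tensor_mult s t = tensor_lift (\<lambda>a b. tensor_lift (\<lambda>c d. (a * c) \<otimes>\<^sub>C (b * d)) t) s"

lemma clinear_tensor_left: "clinear (\<lambda>x. x \<otimes>\<^sub>C y)"
  and clinear_tensor_right: "clinear ((\<otimes>\<^sub>C) x)"
  using cbilinear_tensor unfolding cbilinear_def by auto

lemmas tensor_add_left = clinear_add[OF clinear_tensor_left]
  and tensor_add_right = clinear_add[OF clinear_tensor_right]
  and tensor_scale_left = clinear_scale[OF clinear_tensor_left]
  and tensor_scale_right = clinear_scale[OF clinear_tensor_right]

lemma clinear_tensor_lift_parameter:
  assumes "\<And>p. cbilinear (f p)" "\<And>a b. clinear (\<lambda>p. f p a b)"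
  shows "clinear (\<lambda>p. tensor_lift (f p) t)"
proof (induction t rule: tensor_induct)
  case (tensor a b)
  then show ?case by (simp add: tensor_lift_tensor assms)
next
  case (add s t)
  show ?case
    by (rule clinearI)
      (simp_all add: clinear_add[OF clinear_tensor_lift[OF assms(1)]] clinear_add[OF add(1)]
        clinear_add[OF add(2)] clinear_scale[OF add(1)] clinear_scale[OF add(2)] scaleC_add_right)
qed

lemma map_tensor_tensor:
  assumes "clinear f" "clinear g"
  shows "map_tensor f g (a \<otimes>\<^sub>C b) = f a \<otimes>\<^sub>C g b"
  unfolding map_tensor_def
  by (rule tensor_lift_tensor, unfold cbilinear_def, intro conjI allI clinearI)
    (simp_all add: clinear_add[OF assms(1)] clinear_add[OF assms(2)] clinear_scale[OF assms(1)]
      clinear_scale[OF assms(2)] tensor_add_left tensor_add_right tensor_scale_left tensor_scale_right)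

lemma tensor_assoc_tensor:
  fixes a :: "'a::complex_vector" and b :: "'b::complex_vector" and c :: "'c::complex_vector"
  shows "tensor_assoc ((a \<otimes>\<^sub>C b) \<otimes>\<^sub>C c) = a \<otimes>\<^sub>C (b \<otimes>\<^sub>C c)"
proof -
  have 1: "cbilinear (\<lambda>(a::'a) (b::'b). a \<otimes>\<^sub>C (b \<otimes>\<^sub>C c))" for c :: 'c
    unfolding cbilinear_def
    by (intro conjI allI clinearI)
      (simp_all add: tensor_add_left tensor_add_right tensor_scale_left tensor_scale_right)
  have 2: "clinear (\<lambda>c::'c. a \<otimes>\<^sub>C (b \<otimes>\<^sub>C c))" for a :: 'a and b :: 'b
    by (rule clinearI) (simp_all add: tensor_add_right tensor_scale_right)
  have "cbilinear (\<lambda>s c. tensor_lift (\<lambda>a b. a \<otimes>\<^sub>C (b \<otimes>\<^sub>C c)) (s :: ('a, 'b) tensor) :: ('a, ('b, 'c) tensor) tensor)"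
    using clinear_tensor_lift[OF 1] clinear_tensor_lift_parameter[OF 1 2]
    by (simp add: cbilinear_def)
  from tensor_lift_tensor[OF this] show ?thesis
    unfolding tensor_assoc_def by (simp add: tensor_lift_tensor[OF 1])
qed

lemma tensor_mult_tensor:
  fixes a c :: "'a::complex_algebra_1" and b d :: "'b::complex_algebra_1"
  shows "tensor_mult (a \<otimes>\<^sub>C b) (c \<otimes>\<^sub>C d) = (a * c) \<otimes>\<^sub>C (b * d)"
proof -
  note simps = distrib_left distrib_right mult_scaleC_left mult_scaleC_right
    tensor_add_left tensor_add_right tensor_scale_left tensor_scale_right
  have 1: "cbilinear (\<lambda>c d. (a * c) \<otimes>\<^sub>C (b * d))" for a :: 'a and b :: 'b
    unfolding cbilinear_def by (intro conjI allI clinearI) (simp_all add: simps)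
  have "cbilinear (\<lambda>a b. tensor_lift (\<lambda>c d. (a * c) \<otimes>\<^sub>C (b * d)) t)" for t :: "('a, 'b) tensor"
    unfolding cbilinear_def
    by (intro conjI allI; rule clinear_tensor_lift_parameter; (rule 1)?)
      (rule clinearI; simp add: simps)+
  from tensor_lift_tensor[OF this] show ?thesis
    unfolding tensor_mult_def by (rule trans[OF _ tensor_lift_tensor[OF 1]])
qed

text \<open>The image of \<open>A \<otimes> B\<close> in the tensor product of the ambient spaces.\<close>

definition tensor_subspace ::
    "'a::complex_vector set \<Rightarrow> 'b::complex_vector set \<Rightarrow> ('a, 'b) tensor set" where
  "tensor_subspace A B = complex_vector.span {a \<otimes>\<^sub>C b | a b. a \<in> A \<and> b \<in> B}"


section \<open>Hopf algebras\<close>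

locale bialgebra =
  fixes comult :: "'h::complex_algebra_1 \<Rightarrow> ('h, 'h) tensor"
    and counit :: "'h \<Rightarrow> complex"
  assumes comult_linear: "clinear comult"
    and counit_linear: "clinear counit"
    and coassoc: "tensor_assoc (map_tensor comult id (comult h)) = map_tensor id comult (comult h)"
    and counit_left: "tensor_lift (\<lambda>a b. counit a *\<^sub>C b) (comult h) = h"
    and counit_right: "tensor_lift (\<lambda>a b. counit b *\<^sub>C a) (comult h) = h"
    and comult_mult: "comult (g * h) = tensor_mult (comult g) (comult h)"
    and comult_one: "comult 1 = 1 \<otimes>\<^sub>C 1"
    and counit_mult: "counit (g * h) = counit g * counit h"
    and counit_one: "counit 1 = 1"

locale hopf_algebra = bialgebra comult counit
  for comult :: "'h::complex_algebra_1 \<Rightarrow> ('h, 'h) tensor"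
    and counit :: "'h \<Rightarrow> complex" +
  fixes antipode :: "'h \<Rightarrow> 'h"
  assumes antipode_linear: "clinear antipode"
    and antipode_left: "tensor_lift (\<lambda>a b. antipode a * b) (comult h) = counit h *\<^sub>C 1"
    and antipode_right: "tensor_lift (\<lambda>a b. a * antipode b) (comult h) = counit h *\<^sub>C 1"

definition two_sided_ideal :: "'h::complex_algebra_1 set \<Rightarrow> bool" where
  "two_sided_ideal I \<longleftrightarrow> complex_vector.subspace I \<and> (\<forall>x\<in>I. \<forall>h. h * x \<in> I \<and> x * h \<in> I)"

definition bialgebra_ideal ::
    "('h::complex_algebra_1 \<Rightarrow> ('h, 'h) tensor) \<Rightarrow> ('h \<Rightarrow> complex) \<Rightarrow> 'h set \<Rightarrow> bool" where
  "bialgebra_ideal comult counit I \<longleftrightarrow>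
     two_sided_ideal I \<and>
     comult ` I \<subseteq> {s + t | s t. s \<in> tensor_subspace UNIV I \<and> t \<in> tensor_subspace I UNIV} \<and>
     counit ` I \<subseteq> {0}"

definition hopf_ideal ::
    "('h::complex_algebra_1 \<Rightarrow> ('h, 'h) tensor) \<Rightarrow> ('h \<Rightarrow> complex) \<Rightarrow> ('h \<Rightarrow> 'h) \<Rightarrow> 'h set \<Rightarrow> bool" where
  "hopf_ideal comult counit antipode I \<longleftrightarrow>
     bialgebra_ideal comult counit I \<and> antipode ` I \<subseteq> I"


section \<open>Vertex algebras\<close>

text \<open>A vertex operator map is represented by its modes: \<open>Y u n v\<close> is \<open>u\<^sub>n v\<close>, so the
  coefficient of \<open>z\<^sup>k\<close> in \<open>Y(u,z)v\<close> is \<open>Y u (- k - 1) v\<close>.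

  A formal distribution in \<open>z\<^sub>0\<close>, \<open>z\<^sub>1\<close>, \<open>z\<^sub>2\<close> is the function sending \<open>a b c\<close> to the
  coefficient of \<open>z\<^sub>0\<^sup>a z\<^sub>1\<^sup>b z\<^sub>2\<^sup>c\<close>.\<close>

type_synonym 'a formal_distribution = "int \<Rightarrow> int \<Rightarrow> int \<Rightarrow> 'a"

text \<open>The coefficient of \<open>x\<^sup>j y\<^sup>k\<close> in \<open>(x - y)\<^sup>n\<close>, expanded in nonnegative powers of \<open>y\<close>.\<close>

definition binomial_coeff :: "int \<Rightarrow> int \<Rightarrow> int \<Rightarrow> complex" where
  "binomial_coeff n j k =
     (if 0 \<le> k \<and> j + k = n then (-1) ^ nat k * (of_int n gchoose nat k) else 0)"

text \<open>The three delta functions of the Jacobi identity: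
  \<open>z\<^sub>0\<inverse> \<delta>((z\<^sub>1 - z\<^sub>2) / z\<^sub>0) = \<Sum>\<^sub>n z\<^sub>0\<^sup>-\<^sup>n\<^sup>-\<^sup>1 (z\<^sub>1 - z\<^sub>2)\<^sup>n\<close>,
  \<open>z\<^sub>0\<inverse> \<delta>((z\<^sub>2 - z\<^sub>1) / (- z\<^sub>0)) = \<Sum>\<^sub>n (-1)\<^sup>n z\<^sub>0\<^sup>-\<^sup>n\<^sup>-\<^sup>1 (z\<^sub>2 - z\<^sub>1)\<^sup>n\<close> and
  \<open>z\<^sub>2\<inverse> \<delta>((z\<^sub>1 - z\<^sub>0) / z\<^sub>2) = \<Sum>\<^sub>n z\<^sub>2\<^sup>-\<^sup>n\<^sup>-\<^sup>1 (z\<^sub>1 - z\<^sub>0)\<^sup>n\<close>.\<close>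

definition delta_12 :: "complex formal_distribution" where
  "delta_12 a b c = binomial_coeff (- a - 1) b c"

definition delta_21 :: "complex formal_distribution" where
  "delta_21 a b c = (-1) powi (- a - 1) * binomial_coeff (- a - 1) c b"

definition delta_10 :: "complex formal_distribution" where
  "delta_10 a b c = binomial_coeff (- c - 1) b a"

text \<open>\<open>Sum_any\<close> is \<open>0\<close> on infinite support; \<open>jacobi_products_finite\<close> below shows that all sums
  arising in the Jacobi identity have finite support.\<close>

definition distribution_mult ::
    "complex formal_distribution \<Rightarrow> 'v::complex_vector formal_distribution \<Rightarrow> 'v formal_distribution" where
  "distribution_mult d A a b c = Sum_any (\<lambda>(i, j, k). d (a - i) (b - j) (c - k) *\<^sub>C A i j k)"

text \<open>\<open>Y(u,z\<^sub>1) Y(v,z\<^sub>2) w\<close>, \<open>Y(v,z\<^sub>2) Y(u,z\<^sub>1) w\<close> and \<open>Y(Y(u,z\<^sub>0)v,z\<^sub>2) w\<close>.\<close>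

definition product_12 ::
    "('v \<Rightarrow> int \<Rightarrow> 'v \<Rightarrow> 'v::complex_vector) \<Rightarrow> 'v \<Rightarrow> 'v \<Rightarrow> 'v \<Rightarrow> 'v formal_distribution" where
  "product_12 Y u v w a b c = (if a = 0 then Y u (- b - 1) (Y v (- c - 1) w) else 0)"

definition product_21 ::
    "('v \<Rightarrow> int \<Rightarrow> 'v \<Rightarrow> 'v::complex_vector) \<Rightarrow> 'v \<Rightarrow> 'v \<Rightarrow> 'v \<Rightarrow> 'v formal_distribution" where
  "product_21 Y u v w a b c = (if a = 0 then Y v (- c - 1) (Y u (- b - 1) w) else 0)"

definition iterate_02 ::
    "('v \<Rightarrow> int \<Rightarrow> 'v \<Rightarrow> 'v::complex_vector) \<Rightarrow> 'v \<Rightarrow> 'v \<Rightarrow> 'v \<Rightarrow> 'v formal_distribution" where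
  "iterate_02 Y u v w a b c = (if b = 0 then Y (Y u (- a - 1) v) (- c - 1) w else 0)"

locale vertex_algebra =
  fixes vac :: "'v::complex_vector"
    and Y :: "'v \<Rightarrow> int \<Rightarrow> 'v \<Rightarrow> 'v"
  assumes Y_bilinear: "cbilinear (\<lambda>u v. Y u n v)"
    and truncation: "\<exists>N. \<forall>n\<ge>N. Y u n v = 0"
    and vacuum: "Y vac n v = (if n = -1 then v else 0)"
    and creation: "n \<ge> 0 \<Longrightarrow> Y u n vac = 0" "Y u (-1) vac = u"
    and jacobi:
      "distribution_mult delta_12 (product_12 Y u v w) a b c
         - distribution_mult delta_21 (product_21 Y u v w) a b c
       = distribution_mult delta_10 (iterate_02 Y u v w) a b c"

lemma jacobi_products_finite:
  fixes Y :: "'v::complex_vector \<Rightarrow> int \<Rightarrow> 'v \<Rightarrow> 'v"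
  assumes bilin: "\<And>n. cbilinear (\<lambda>u v. Y u n v)"
    and trunc: "\<And>u v. \<exists>N. \<forall>n\<ge>N. Y u n v = 0"
  shows "finite {x. (\<lambda>(i, j, k). delta_12 (a - i) (b - j) (c - k) *\<^sub>C product_12 Y u v w i j k) x \<noteq> 0}"
    and "finite {x. (\<lambda>(i, j, k). delta_21 (a - i) (b - j) (c - k) *\<^sub>C product_21 Y u v w i j k) x \<noteq> 0}"
    and "finite {x. (\<lambda>(i, j, k). delta_10 (a - i) (b - j) (c - k) *\<^sub>C iterate_02 Y u v w i j k) x \<noteq> 0}"
proof -
  have zero_right: "Y u n 0 = 0" for u n
    using clinear_scale[of "Y u n" 0 0] bilin[of n] by (simp add: cbilinear_def)
  have zero_left: "Y 0 n v = 0" for v n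
    using clinear_scale[of "\<lambda>u. Y u n v" 0 0] bilin[of n] by (simp add: cbilinear_def)
  obtain N1 where N1: "n \<ge> N1 \<Longrightarrow> Y v n w = 0" for n using trunc by blast
  obtain N2 where N2: "n \<ge> N2 \<Longrightarrow> Y u n w = 0" for n using trunc by blast
  obtain N3 where N3: "n \<ge> N3 \<Longrightarrow> Y u n v = 0" for n using trunc by blast
  show "finite {x. (\<lambda>(i, j, k). delta_12 (a - i) (b - j) (c - k) *\<^sub>C product_12 Y u v w i j k) x \<noteq> 0}"
  proof (rule finite_subset)
    show "finite ((\<lambda>k. (0, a + b + c + 1 - k, k)) ` {- N1 - 1..c})" by simp
    show "{x. (\<lambda>(i, j, k). delta_12 (a - i) (b - j) (c - k) *\<^sub>C product_12 Y u v w i j k) x \<noteq> 0}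
        \<subseteq> (\<lambda>k. (0, a + b + c + 1 - k, k)) ` {- N1 - 1..c}"
    proof (rule subsetI)
      fix x
      assume x: "x \<in> {x. (\<lambda>(i, j, k). delta_12 (a - i) (b - j) (c - k) *\<^sub>C product_12 Y u v w i j k) x \<noteq> 0}"
      obtain i j k where ijk: "x = (i, j, k)" by (rule prod_cases3)
      have "delta_12 (a - i) (b - j) (c - k) *\<^sub>C product_12 Y u v w i j k \<noteq> 0"
        using x unfolding ijk by simp
      then have "delta_12 (a - i) (b - j) (c - k) \<noteq> 0" "product_12 Y u v w i j k \<noteq> 0" by auto
      then have "i = 0" "c - k \<ge> 0" "b - j + (c - k) = - (a - i) - 1" "Y v (- k - 1) w \<noteq> 0"
        by (auto simp: delta_12_def binomial_coeff_def product_12_def zero_right split: if_splits)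
      then show "x \<in> (\<lambda>k. (0, a + b + c + 1 - k, k)) ` {- N1 - 1..c}"
        using N1[of "- k - 1"] unfolding ijk by force
    qed
  qed
  show "finite {x. (\<lambda>(i, j, k). delta_21 (a - i) (b - j) (c - k) *\<^sub>C product_21 Y u v w i j k) x \<noteq> 0}"
  proof (rule finite_subset)
    show "finite ((\<lambda>j. (0, j, a + b + c + 1 - j)) ` {- N2 - 1..b})" by simp
    show "{x. (\<lambda>(i, j, k). delta_21 (a - i) (b - j) (c - k) *\<^sub>C product_21 Y u v w i j k) x \<noteq> 0}
        \<subseteq> (\<lambda>j. (0, j, a + b + c + 1 - j)) ` {- N2 - 1..b}"
    proof (rule subsetI)
      fix x
      assume x: "x \<in> {x. (\<lambda>(i, j, k). delta_21 (a - i) (b - j) (c - k) *\<^sub>C product_21 Y u v w i j k) x \<noteq> 0}"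
      obtain i j k where ijk: "x = (i, j, k)" by (rule prod_cases3)
      have "delta_21 (a - i) (b - j) (c - k) *\<^sub>C product_21 Y u v w i j k \<noteq> 0"
        using x unfolding ijk by simp
      then have "delta_21 (a - i) (b - j) (c - k) \<noteq> 0" "product_21 Y u v w i j k \<noteq> 0" by auto
      then have "i = 0" "b - j \<ge> 0" "b - j + (c - k) = - (a - i) - 1" "Y u (- j - 1) w \<noteq> 0"
        by (auto simp: delta_21_def binomial_coeff_def product_21_def zero_right split: if_splits)
      then show "x \<in> (\<lambda>j. (0, j, a + b + c + 1 - j)) ` {- N2 - 1..b}"
        using N2[of "- j - 1"] unfolding ijk by force
    qed
  qed
  show "finite {x. (\<lambda>(i, j, k). delta_10 (a - i) (b - j) (c - k) *\<^sub>C iterate_02 Y u v w i j k) x \<noteq> 0}"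
  proof (rule finite_subset)
    show "finite ((\<lambda>i. (i, 0, a + b + c + 1 - i)) ` {- N3 - 1..a})" by simp
    show "{x. (\<lambda>(i, j, k). delta_10 (a - i) (b - j) (c - k) *\<^sub>C iterate_02 Y u v w i j k) x \<noteq> 0}
        \<subseteq> (\<lambda>i. (i, 0, a + b + c + 1 - i)) ` {- N3 - 1..a}"
    proof (rule subsetI)
      fix x
      assume x: "x \<in> {x. (\<lambda>(i, j, k). delta_10 (a - i) (b - j) (c - k) *\<^sub>C iterate_02 Y u v w i j k) x \<noteq> 0}"
      obtain i j k where ijk: "x = (i, j, k)" by (rule prod_cases3)
      have "delta_10 (a - i) (b - j) (c - k) *\<^sub>C iterate_02 Y u v w i j k \<noteq> 0"
        using x unfolding ijk by simp
      then have "delta_10 (a - i) (b - j) (c - k) \<noteq> 0" "iterate_02 Y u v w i j k \<noteq> 0" by auto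
      then have "j = 0" "a - i \<ge> 0" "b - j + (a - i) = - (c - k) - 1" "Y u (- i - 1) v \<noteq> 0"
        by (auto simp: delta_10_def binomial_coeff_def iterate_02_def zero_left split: if_splits)
      then show "x \<in> (\<lambda>i. (i, 0, a + b + c + 1 - i)) ` {- N3 - 1..a}"
        using N3[of "- i - 1"] unfolding ijk by force
    qed
  qed
qed

definition vertex_series ::
    "('v \<Rightarrow> int \<Rightarrow> 'v \<Rightarrow> 'v::complex_vector) \<Rightarrow> 'v \<Rightarrow> 'v \<Rightarrow> 'v fls" where
  "vertex_series Y u v = Abs_fls (\<lambda>k. Y u (- k - 1) v)"

definition pi2 :: "('v \<Rightarrow> int \<Rightarrow> 'v \<Rightarrow> 'v) \<Rightarrow> ('v::complex_vector, 'v) tensor \<Rightarrow> 'v fls" where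
  "pi2 Y = tensor_lift (vertex_series Y)"

context vertex_algebra
begin

lemma vertex_series_nth: "fls_nth (vertex_series Y u v) k = Y u (- k - 1) v"
proof -
  obtain N where "\<forall>n\<ge>N. Y u n v = 0" using truncation by blast
  then show ?thesis
    unfolding vertex_series_def by (intro nth_Abs_fls_lower_bound[of "- N"]) simp
qed

lemma cbilinear_vertex_series: "cbilinear (vertex_series Y)"
  unfolding cbilinear_def
proof (intro conjI allI)
  have Y1: "clinear (Y u n)" and Y2: "clinear (\<lambda>u. Y u n v)" for u v n
    using Y_bilinear[of n] by (auto simp: cbilinear_def)
  show "clinear (vertex_series Y u)" for u
    by (rule clinearI; rule fls_eqI)
      (simp_all add: vertex_series_nth fls_nth_scaleC clinear_add[OF Y1] clinear_scale[OF Y1])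
  show "clinear (\<lambda>u. vertex_series Y u v)" for v
    by (rule clinearI; rule fls_eqI)
      (simp_all add: vertex_series_nth fls_nth_scaleC clinear_add[OF Y2] clinear_scale[OF Y2])
qed

lemma pi2_tensor: "pi2 Y (u \<otimes>\<^sub>C v) = vertex_series Y u v"
  unfolding pi2_def by (rule tensor_lift_tensor[OF cbilinear_vertex_series])

end


section \<open>Module vertex algebras\<close>

text \<open>The last assumption is \<open>h (Y(u,z)v) = \<Sum> Y(h\<^sub>1 u, z) h\<^sub>2 v\<close>, coefficient by coefficient.\<close>

locale module_vertex_algebra =
  hopf_algebra comult counit antipode + vertex_algebra vac Y
  for comult :: "'h::complex_algebra_1 \<Rightarrow> ('h, 'h) tensor"
    and counit :: "'h \<Rightarrow> complex"
    and antipode :: "'h \<Rightarrow> 'h"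
    and vac :: "'v::complex_vector"
    and Y :: "'v \<Rightarrow> int \<Rightarrow> 'v \<Rightarrow> 'v" +
  fixes act :: "'h \<Rightarrow> 'v \<Rightarrow> 'v"
  assumes act_bilinear: "cbilinear act"
    and act_one: "act 1 v = v"
    and act_mult: "act (g * h) v = act g (act h v)"
    and act_vacuum: "act h vac = counit h *\<^sub>C vac"
    and act_vertex:
      "act h (Y u n v) = tensor_lift (\<lambda>h\<^sub>1 h\<^sub>2. Y (act h\<^sub>1 u) n (act h\<^sub>2 v)) (comult h)"

definition action_kernel :: "('h \<Rightarrow> 'v \<Rightarrow> 'v::zero) \<Rightarrow> 'h set" where
  "action_kernel act = {h. \<forall>v. act h v = 0}"

end

theory Submission
  imports Defs
begin

text \<open>Let \<open>K\<close> be the kernel of the action and \<open>M = H \<otimes> K + K \<otimes> H\<close>.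
  If \<open>h \<in> K\<close>, then \<open>\<pi>\<^sub>2\<close> maps \<open>\<Sum> h\<^sub>1 u \<otimes> h\<^sub>2 v\<close> to \<open>h (Y(u,z)v) = 0\<close>, so
  \<open>\<Sum> h\<^sub>1 u \<otimes> h\<^sub>2 v = 0\<close> for all \<open>u, v\<close>. Since \<open>H/K\<close> acts faithfully, this forces
  \<open>\<Delta>(h) \<in> M\<close>; and \<open>h\<one> = \<epsilon>(h)\<one>\<close> gives \<open>\<epsilon>(h) = 0\<close>.

  For the antipode, the Galois map \<open>\<beta>(a \<otimes> b) = \<Sum> a b\<^sub>1 \<otimes> b\<^sub>2\<close> on \<open>H \<otimes> H\<close> has the left inverse
  \<open>\<gamma>(a \<otimes> b) = \<Sum> a S(b\<^sub>1) \<otimes> b\<^sub>2\<close> and preserves \<open>M\<close>. In finite dimension, \<open>\<beta>(M) = M\<close>, hence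
  \<open>\<gamma>(M) = M\<close>. For \<open>k \<in> K\<close>, applying \<open>id \<otimes> \<epsilon>\<close> to \<open>\<gamma>(1 \<otimes> k) \<in> M\<close> shows \<open>S(k) \<in> K\<close>.\<close>

section \<open>Linear and bilinear maps on tensor products\<close>

lemma cbilinearI:
  assumes "\<And>x. clinear (f x)" "\<And>y. clinear (\<lambda>x. f x y)"
  shows "cbilinear f"
  using assms by (simp add: cbilinear_def)

lemma cbilinear_clinear_left: "cbilinear f \<Longrightarrow> clinear (\<lambda>x. f x y)"
  and cbilinear_clinear_right: "cbilinear f \<Longrightarrow> clinear (f x)"
  by (simp_all add: cbilinear_def)

lemma clinear_zero: "clinear f \<Longrightarrow> f 0 = 0"
  by (rule module_hom.zero[OF module_hom_linearI])

lemma clinear_sum: "clinear f \<Longrightarrow> f (sum g A) = (\<Sum>a\<in>A. f (g a))"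
  by (rule module_hom.sum[OF module_hom_linearI])

lemma clinear_diff: "clinear f \<Longrightarrow> f (x - y) = f x - f y"
  by (rule module_hom.diff[OF module_hom_linearI])

lemma clinear_compose:
  assumes "clinear f" "clinear g"
  shows "clinear (\<lambda>x. f (g x))"
  by (rule clinearI) (simp_all add: clinear_add[OF assms(1)] clinear_add[OF assms(2)]
      clinear_scale[OF assms(1)] clinear_scale[OF assms(2)])

lemma clinear_mult_left: "clinear ((*) (a :: 'a::complex_algebra_1))"
  by (rule clinearI) (simp_all add: distrib_left mult_scaleC_right)

lemma clinear_mult_right: "clinear (\<lambda>x. x * (a :: 'a::complex_algebra_1))"
  by (rule clinearI) (simp_all add: distrib_right mult_scaleC_left)

lemma clinear_functional_scale:
  "clinear (g :: 'a::complex_vector \<Rightarrow> complex) \<Longrightarrow> clinear (\<lambda>x. g x *\<^sub>C y)"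
  by (rule clinearI)
    (simp_all add: clinear_add clinear_scale scaleC_add_left scaleC_scaleC scaleC_complex_def)

lemma clinear_scaleC: "clinear ((*\<^sub>C) c :: 'a::complex_vector \<Rightarrow> 'a)"
  by (rule clinearI) (simp_all add: scaleC_add_right scaleC_scaleC mult.commute)

lemma clinear_map_tensor:
  assumes "clinear f" "clinear g"
  shows "clinear (map_tensor f g)"
  unfolding map_tensor_def
  by (intro clinear_tensor_lift cbilinearI clinear_compose[OF clinear_tensor_left]
      clinear_compose[OF clinear_tensor_right] assms)

lemma clinear_tensor_assoc:
  "clinear (tensor_assoc :: (('a::complex_vector, 'b::complex_vector) tensor, 'c::complex_vector) tensor \<Rightarrow> _)"
proof -
  have 1: "cbilinear (\<lambda>(a::'a) (b::'b). a \<otimes>\<^sub>C (b \<otimes>\<^sub>C c))" for c :: 'c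
    by (intro cbilinearI clinear_compose[OF clinear_tensor_right] clinear_tensor_left)
  show ?thesis
    unfolding tensor_assoc_def
    by (intro clinear_tensor_lift cbilinearI clinear_tensor_lift_parameter 1
        clinear_compose[OF clinear_tensor_right] clinear_tensor_right)
qed

section \<open>Reduction to pure tensors and to generators\<close>

lemma clinear_eq_on_tensors:
  assumes "clinear f" "clinear g" "\<And>a b. f (a \<otimes>\<^sub>C b) = g (a \<otimes>\<^sub>C b)"
  shows "f t = g t"
  by (induction t rule: tensor_induct)
    (simp_all add: assms(3) clinear_add[OF assms(1)] clinear_add[OF assms(2)])

text \<open>Moves a linear map inside a Sweedler sum
  \<open>tensor_lift f (comult h)\<close>.\<close>

lemma clinear_comp_tensor_lift:
  assumes "clinear g" "cbilinear f"
  shows "g (tensor_lift f t) = tensor_lift (\<lambda>a b. g (f a b)) t"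
proof (rule clinear_eq_on_tensors[where f = "\<lambda>t. g (tensor_lift f t)"])
  have b: "cbilinear (\<lambda>a b. g (f a b))"
    by (intro cbilinearI clinear_compose[OF assms(1)] cbilinear_clinear_left[OF assms(2)]
        cbilinear_clinear_right[OF assms(2)])
  show "clinear (\<lambda>t. g (tensor_lift f t))"
    by (rule clinear_compose[OF assms(1) clinear_tensor_lift[OF assms(2)]])
  show "clinear (tensor_lift (\<lambda>a b. g (f a b)))"
    by (rule clinear_tensor_lift[OF b])
  show "g (tensor_lift f (x \<otimes>\<^sub>C y)) = tensor_lift (\<lambda>a b. g (f a b)) (x \<otimes>\<^sub>C y)" for x y
    by (simp add: tensor_lift_tensor assms b)
qed

text \<open>Serves maps in which \<open>a\<close> enters the summand while \<open>b\<close> enters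
  through \<open>g = comult\<close>, as in the Galois map.\<close>

lemma cbilinear_tensor_lift:
  assumes "\<And>a. cbilinear (f a)" "\<And>x y. clinear (\<lambda>a. f a x y)" "clinear g"
  shows "cbilinear (\<lambda>a b. tensor_lift (f a) (g b))"
  by (intro cbilinearI clinear_tensor_lift_parameter assms
      clinear_compose[OF clinear_tensor_lift assms(3)])

lemma clinear_span_subset:
  assumes "clinear f" "complex_vector.subspace P" "\<And>x. x \<in> X \<Longrightarrow> f x \<in> P"
    and "x \<in> complex_vector.span X"
  shows "f x \<in> P"
  using assms(4)
proof (induction rule: complex_vector.span_induct_alt)
  case base
  then show ?case using assms(1,2) by (simp add: clinear_zero complex_vector.subspace_0)
next
  case (step c x y)
  then show ?case
    using assms by (simp add: clinear_add clinear_scale complex_vector.subspace_add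
        complex_vector.subspace_scale)
qed

section \<open>Functionals, complements and expansions modulo a subspace\<close>

lemma functional_nonzero:
  fixes w :: "'a::complex_vector"
  assumes "w \<noteq> 0"
  obtains g :: "'a \<Rightarrow> complex" where "clinear g" "g w \<noteq> 0"
proof
  \<comment> \<open>The functional is the coordinate at \<open>w\<close> in a basis containing
    \<open>w\<close>.\<close>
  let ?B = "complex_vector.extend_basis {w}"
  have ind: "complex_vector.independent {w}"
    using assms by (simp add: complex_vector.independent_insert)
  note B = complex_vector.independent_extend_basis[OF ind]
    complex_vector.span_extend_basis[OF ind]
  show "clinear (\<lambda>x. complex_vector.representation ?B x w)"
    by (rule clinearI)
      (simp_all add: complex_vector.representation_add complex_vector.representation_scale B
        scaleC_complex_def)
  have "w \<in> ?B"
    using complex_vector.extend_basis_superset[OF ind] by simp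
  then show "complex_vector.representation ?B w w \<noteq> 0"
    using complex_vector.representation_basis[OF B(1)] by simp
qed

text \<open>\<open>D\<close> stands in for a basis of the quotient by \<open>K\<close>: it spans
  modulo \<open>K\<close> and is independent modulo \<open>K\<close>. It consists of the vectors
  added when a basis \<open>C\<close> of \<open>K\<close> is extended to the whole space.\<close>

lemma complement_basis:
  fixes K :: "'a::complex_vector set"
  assumes K: "complex_vector.subspace K"
  obtains D where "\<And>x. \<exists>k\<in>K. \<exists>y\<in>complex_vector.span D. x = k + y"
    and "\<And>F c d. \<lbrakk>finite F; F \<subseteq> D; (\<Sum>d\<in>F. c d *\<^sub>C d) \<in> K; d \<in> F\<rbrakk> \<Longrightarrow> c d = 0"
proof -
  obtain C where C: "C \<subseteq> K" "complex_vector.independent C" "complex_vector.span C = K"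
    using complex_vector.maximal_independent_subset[of K] K
    by (metis complex_vector.span_eq_iff complex_vector.span_mono subset_antisym)
  define B where "B = complex_vector.extend_basis C"
  have B: "complex_vector.independent B" "complex_vector.span B = UNIV" "C \<subseteq> B"
    unfolding B_def using complex_vector.independent_extend_basis[OF C(2)]
      complex_vector.span_extend_basis[OF C(2)] complex_vector.extend_basis_superset[OF C(2)]
    by auto
  show thesis
  proof (rule that[of "B - C"])
    fix x
    have "x \<in> complex_vector.span (C \<union> (B - C))"
      using B by (simp add: Un_absorb1)
    then show "\<exists>k\<in>K. \<exists>y\<in>complex_vector.span (B - C). x = k + y"
      unfolding complex_vector.span_Un C(3) by blast
  next
    fix F and c :: "'a \<Rightarrow> complex" and d
    assume F: "finite F" "F \<subseteq> B - C" "(\<Sum>d\<in>F. c d *\<^sub>C d) \<in> K" "d \<in> F"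
    let ?S = "complex_vector.span (B - {d})"
    show "c d = 0"
    proof (rule ccontr)
      assume "c d \<noteq> 0"
      \<comment> \<open>As \<open>d\<close> lies outside \<open>C\<close>, solving the relation for
        \<open>d\<close> would place it in the span of the other basis vectors.\<close>
      have "K \<subseteq> ?S"
        unfolding C(3)[symmetric] using F B(3) by (intro complex_vector.span_mono) auto
      moreover have "(\<Sum>e\<in>F - {d}. c e *\<^sub>C e) \<in> ?S"
        using F(2) by (intro complex_vector.span_sum complex_vector.span_scale
            complex_vector.span_base) auto
      ultimately have "(\<Sum>e\<in>F. c e *\<^sub>C e) - (\<Sum>e\<in>F - {d}. c e *\<^sub>C e) \<in> ?S"
        using F(3) by (intro complex_vector.span_diff) auto
      then have "c d *\<^sub>C d \<in> ?S"
        using F by (simp add: sum.remove[of F d])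
      then have "d \<in> ?S"
        using \<open>c d \<noteq> 0\<close> complex_vector.span_scale[of "c d *\<^sub>C d" _ "inverse (c d)"]
        by (simp add: scaleC_scaleC scaleC_one)
      then show False
        using B(1) F(2,4) unfolding complex_vector.dependent_def by blast
    qed
  qed
qed

text \<open>Splitting the left factor of a pure tensor as \<open>k + y\<close> leaves the error
  \<open>k \<otimes>\<^sub>C b\<close>; the coefficients of \<open>y\<close> over \<open>D\<close>
  move to the right factor.\<close>

lemma tensor_modulo_subspace:
  fixes t :: "('a::complex_vector, 'b::complex_vector) tensor"
  assumes D: "\<And>x. \<exists>k\<in>K. \<exists>y\<in>complex_vector.span D. x = k + y"
  shows "\<exists>F c. finite F \<and> F \<subseteq> D \<and> t - (\<Sum>d\<in>F. d \<otimes>\<^sub>C c d) \<in> tensor_subspace K UNIV"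
proof (induction t rule: tensor_induct)
  case (tensor a b)
  obtain k y where k: "k \<in> K" and y: "y \<in> complex_vector.span D" and a: "a = k + y"
    using D by blast
  obtain F c where F: "finite F" "F \<subseteq> D" "y = (\<Sum>d\<in>F. c d *\<^sub>C d)"
    using y unfolding complex_vector.span_explicit by blast
  have "y \<otimes>\<^sub>C b = (\<Sum>d\<in>F. d \<otimes>\<^sub>C (c d *\<^sub>C b))"
    unfolding F(3) clinear_sum[OF clinear_tensor_left]
    by (simp add: tensor_scale_left tensor_scale_right)
  then have "a \<otimes>\<^sub>C b - (\<Sum>d\<in>F. d \<otimes>\<^sub>C (c d *\<^sub>C b)) = k \<otimes>\<^sub>C b"
    by (simp add: a tensor_add_left)
  moreover have "k \<otimes>\<^sub>C b \<in> tensor_subspace K UNIV"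
    unfolding tensor_subspace_def using k by (intro complex_vector.span_base) auto
  ultimately show ?case
    using F(1,2) by (intro exI[of _ F] exI[of _ "\<lambda>d. c d *\<^sub>C b"]) simp
next
  case (add s t)
  obtain F c where F: "finite F" "F \<subseteq> D" "s - (\<Sum>d\<in>F. d \<otimes>\<^sub>C c d) \<in> tensor_subspace K UNIV"
    using add.IH(1) by blast
  obtain G e where G: "finite G" "G \<subseteq> D" "t - (\<Sum>d\<in>G. d \<otimes>\<^sub>C e d) \<in> tensor_subspace K UNIV"
    using add.IH(2) by blast
  \<comment> \<open>Both coefficient families are extended by zero to \<open>F \<union> G\<close>,
    so that the sums add term by term.\<close>
  define f where "f d = (if d \<in> F then c d else 0) + (if d \<in> G then e d else 0)" for d
  have *: "(\<Sum>d\<in>A. d \<otimes>\<^sub>C h d) = (\<Sum>d\<in>F \<union> G. d \<otimes>\<^sub>C (if d \<in> A then h d else 0))"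
    if "A \<subseteq> F \<union> G" for A h
    using that F(1) G(1)
    by (intro sum.mono_neutral_cong_left) (auto simp: clinear_zero[OF clinear_tensor_right])
  have "s + t - (\<Sum>d\<in>F \<union> G. d \<otimes>\<^sub>C f d)
      = (s - (\<Sum>d\<in>F. d \<otimes>\<^sub>C c d)) + (t - (\<Sum>d\<in>G. d \<otimes>\<^sub>C e d))"
    by (simp add: *[of F] *[of G] f_def tensor_add_right sum.distrib)
  also have "\<dots> \<in> tensor_subspace K UNIV"
    using F(3) G(3) unfolding tensor_subspace_def by (rule complex_vector.span_add)
  finally show ?case
    using F G by (intro exI[of _ "F \<union> G"] exI[of _ f]) auto
qed

section \<open>Kernels in tensor squares\<close>

text \<open>For a subspace \<open>K\<close> of H this is the kernel of the projection from H
  \<otimes> H to H/K \<otimes> H/K. The set has the same form as in \<open>bialgebra_ideal\<close>,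
  so the coproduct condition there reads \<open>comult h \<in> tensor_ideal K\<close>.\<close>

definition tensor_ideal :: "'a::complex_vector set \<Rightarrow> ('a, 'a) tensor set" where
  "tensor_ideal K = {s + t | s t. s \<in> tensor_subspace UNIV K \<and> t \<in> tensor_subspace K UNIV}"

lemma tensor_ideal_span:
  "tensor_ideal K = complex_vector.span {a \<otimes>\<^sub>C b | a b. a \<in> K \<or> b \<in> K}"
proof -
  have "{a \<otimes>\<^sub>C b | a b. a \<in> K \<or> b \<in> K}
      = {a \<otimes>\<^sub>C b | a b. a \<in> UNIV \<and> b \<in> K} \<union> {a \<otimes>\<^sub>C b | a b. a \<in> K \<and> b \<in> UNIV}"
    by blast
  then show ?thesis
    by (simp add: tensor_ideal_def tensor_subspace_def complex_vector.span_Un)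
qed

lemma subspace_tensor_ideal: "complex_vector.subspace (tensor_ideal K)"
  unfolding tensor_ideal_span by (rule complex_vector.subspace_span)

lemma tensor_in_tensor_ideal: "a \<in> K \<or> b \<in> K \<Longrightarrow> a \<otimes>\<^sub>C b \<in> tensor_ideal K"
  unfolding tensor_ideal_span by (rule complex_vector.span_base) blast

lemma clinear_tensor_ideal_subset:
  assumes "clinear f" "complex_vector.subspace P"
    and "\<And>a b. a \<in> K \<or> b \<in> K \<Longrightarrow> f (a \<otimes>\<^sub>C b) \<in> P"
    and "t \<in> tensor_ideal K"
  shows "f t \<in> P"
  by (rule clinear_span_subset[OF assms(1,2) _ assms(4)[unfolded tensor_ideal_span]])
    (use assms(3) in blast)

lemma subspace_action_kernel:
  assumes "cbilinear act"
  shows "complex_vector.subspace (action_kernel act)"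
  unfolding complex_vector.subspace_def action_kernel_def
  using clinear_zero[OF cbilinear_clinear_left[OF assms]]
    clinear_add[OF cbilinear_clinear_left[OF assms]]
    clinear_scale[OF cbilinear_clinear_left[OF assms]]
  by simp

text \<open>The second hypothesis says that \<open>t\<close> acts as zero on V \<otimes> V.
  Expanding \<open>t\<close> modulo the kernel in the left factor, over vectors \<open>d\<close>
  independent modulo the kernel, it remains to show that each coefficient \<open>c d\<close> acts as
  zero. Functionals on the second factor of V \<otimes> V turn the hypothesis into relations among
  the \<open>d\<close>.\<close>

lemma tensor_ideal_action_kernel:
  fixes act :: "'h::complex_vector \<Rightarrow> 'v::complex_vector \<Rightarrow> 'v"
  assumes act: "cbilinear act"
    and t: "\<And>u v. tensor_lift (\<lambda>a b. act a u \<otimes>\<^sub>C act b v) t = 0"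
  shows "t \<in> tensor_ideal (action_kernel act)"
proof -
  let ?K = "action_kernel act"
  note L = cbilinear_clinear_left[OF act]
  obtain D where D1: "\<And>x. \<exists>k\<in>?K. \<exists>y\<in>complex_vector.span D. x = k + y"
    and D2: "\<And>F c d. \<lbrakk>finite F; F \<subseteq> D; (\<Sum>d\<in>F. c d *\<^sub>C d) \<in> ?K; d \<in> F\<rbrakk> \<Longrightarrow> c d = 0"
    by (rule complement_basis[OF subspace_action_kernel[OF act]]) (rule that)
  obtain F c where F: "finite F" "F \<subseteq> D"
    and r: "t - (\<Sum>d\<in>F. d \<otimes>\<^sub>C c d) \<in> tensor_subspace ?K UNIV"
    using tensor_modulo_subspace[OF D1] by blast
  have "c d \<in> ?K" if d: "d \<in> F" for d
  proof (rule ccontr)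
    assume "c d \<notin> ?K"
    then obtain v where "act (c d) v \<noteq> 0" by (auto simp: action_kernel_def)
    then obtain g :: "'v \<Rightarrow> complex" where g: "clinear g" "g (act (c d) v) \<noteq> 0"
      by (rule functional_nonzero)
    \<comment> \<open>A relation modulo the kernel whose coefficient at the fixed \<open>d\<close>
      is nonzero by the choice of \<open>g\<close>, against independence.\<close>
    have "act (\<Sum>d\<in>F. g (act (c d) v) *\<^sub>C d) u = 0" for u
    proof -
      \<comment> \<open>\<open>f\<close> applies \<open>g\<close> to the second factor of
        \<open>act a u \<otimes>\<^sub>C act b v\<close>. It vanishes at \<open>t\<close> by
        hypothesis, and on \<open>tensor_subspace ?K UNIV\<close> because the left factors there act
        as zero.\<close>
      define f where "f = tensor_lift (\<lambda>a b. g (act b v) *\<^sub>C act a u)"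
      have b0: "cbilinear (\<lambda>x y. g y *\<^sub>C x :: 'v)"
        by (intro cbilinearI clinear_functional_scale[OF g(1)] clinear_scaleC)
      have b1: "cbilinear (\<lambda>a b. act a u \<otimes>\<^sub>C act b v)"
        by (intro cbilinearI clinear_compose[OF clinear_tensor_left]
            clinear_compose[OF clinear_tensor_right] L)
      have b2: "cbilinear (\<lambda>a b. g (act b v) *\<^sub>C act a u)"
        by (intro cbilinearI clinear_functional_scale clinear_compose[OF g(1)]
            clinear_compose[OF clinear_scaleC] L)
      have f: "clinear f" unfolding f_def by (rule clinear_tensor_lift[OF b2])
      have "f t = tensor_lift (\<lambda>x y. g y *\<^sub>C x) (tensor_lift (\<lambda>a b. act a u \<otimes>\<^sub>C act b v) t)"
        unfolding f_def clinear_comp_tensor_lift[OF clinear_tensor_lift[OF b0] b1]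
        by (simp add: tensor_lift_tensor[OF b0])
      then have "f t = 0"
        by (simp add: t clinear_zero[OF clinear_tensor_lift[OF b0]])
      moreover have "f (t - (\<Sum>d\<in>F. d \<otimes>\<^sub>C c d)) \<in> {0}"
        using r unfolding tensor_subspace_def
        by (rule clinear_span_subset[OF f, rotated -1])
          (auto simp: f_def tensor_lift_tensor[OF b2] action_kernel_def complex_vector.subspace_def)
      ultimately have "f (\<Sum>d\<in>F. d \<otimes>\<^sub>C c d) = 0"
        by (simp add: clinear_diff[OF f])
      then show ?thesis
        by (simp add: clinear_sum[OF f] clinear_sum[OF L] clinear_scale[OF L])
          (simp add: f_def tensor_lift_tensor[OF b2])
    qed
    then have "(\<Sum>d\<in>F. g (act (c d) v) *\<^sub>C d) \<in> ?K"
      by (simp add: action_kernel_def)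
    from D2[OF F this d] g(2) show False by contradiction
  qed
  then have "(\<Sum>d\<in>F. d \<otimes>\<^sub>C c d) \<in> tensor_ideal ?K"
    by (intro complex_vector.subspace_sum subspace_tensor_ideal tensor_in_tensor_ideal) auto
  moreover have "t - (\<Sum>d\<in>F. d \<otimes>\<^sub>C c d) \<in> tensor_ideal ?K"
    using r unfolding tensor_ideal_span tensor_subspace_def
    by (rule subsetD[OF complex_vector.span_mono, rotated]) blast
  ultimately show ?thesis
    using complex_vector.subspace_add[OF subspace_tensor_ideal] by (metis diff_add_cancel)
qed

section \<open>The kernel of a vertex algebra action\<close>

text \<open>Injectivity of \<open>pi2 Y\<close> gives the coproduct condition.
  \<open>nonzero\<close> gives the counit condition: for V = 0 the kernel would be all of H,
  although \<open>counit 1 = 1\<close>.\<close>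

lemma (in module_vertex_algebra) bialgebra_ideal_action_kernel:
  assumes nonzero: "\<exists>v::'v. v \<noteq> 0" and inj: "inj (pi2 Y)"
  shows "bialgebra_ideal comult counit (action_kernel act)"
proof -
  let ?K = "action_kernel act"
  note L = cbilinear_clinear_left[OF act_bilinear] and R = cbilinear_clinear_right[OF act_bilinear]
  have "two_sided_ideal ?K"
    unfolding two_sided_ideal_def
    using subspace_action_kernel[OF act_bilinear]
    by (auto simp: action_kernel_def act_mult clinear_zero[OF R])
  moreover have "comult h \<in> tensor_ideal ?K" if h: "h \<in> ?K" for h
  proof (rule tensor_ideal_action_kernel[OF act_bilinear])
    fix u v
    have b: "cbilinear (\<lambda>a b. act a u \<otimes>\<^sub>C act b v)"
      by (intro cbilinearI clinear_compose[OF clinear_tensor_left]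
          clinear_compose[OF clinear_tensor_right] L)
    have lin: "clinear (\<lambda>s. fls_nth (pi2 Y s) k)" for k
      by (rule clinearI) (simp_all add: pi2_def clinear_add[OF clinear_tensor_lift[OF cbilinear_vertex_series]]
          clinear_scale[OF clinear_tensor_lift[OF cbilinear_vertex_series]] fls_nth_scaleC)
    have "pi2 Y (tensor_lift (\<lambda>a b. act a u \<otimes>\<^sub>C act b v) (comult h)) = 0"
    proof (rule fls_eqI)
      fix k
      \<comment> \<open>The coefficient of index \<open>k\<close> is the mode
        \<open>- k - 1\<close>; taking it inside the Sweedler sum makes \<open>act_vertex\<close>
        applicable.\<close>
      have "fls_nth (pi2 Y (tensor_lift (\<lambda>a b. act a u \<otimes>\<^sub>C act b v) (comult h))) k
          = act h (Y u (- k - 1) v)"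
        unfolding clinear_comp_tensor_lift[OF lin b] act_vertex
        by (simp add: pi2_tensor vertex_series_nth)
      then show "fls_nth (pi2 Y (tensor_lift (\<lambda>a b. act a u \<otimes>\<^sub>C act b v) (comult h))) k = fls_nth 0 k"
        using h by (simp add: action_kernel_def)
    qed
    also have "0 = pi2 Y 0"
      by (simp add: pi2_def clinear_zero[OF clinear_tensor_lift[OF cbilinear_vertex_series]])
    finally show "tensor_lift (\<lambda>a b. act a u \<otimes>\<^sub>C act b v) (comult h) = 0"
      by (rule injD[OF inj])
  qed
  moreover have "counit h = 0" if "h \<in> ?K" for h
  proof -
    obtain v :: 'v where "v \<noteq> 0" using nonzero by blast
    \<comment> \<open>\<open>Y vac (-1)\<close> is the identity, while \<open>Y 0 (-1)\<close>
      vanishes.\<close>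
    then have "vac \<noteq> 0"
      using vacuum[of "-1" v] clinear_zero[OF cbilinear_clinear_left[OF Y_bilinear]] by auto
    moreover have "counit h *\<^sub>C vac = 0"
      using that act_vacuum[of h] by (simp add: action_kernel_def)
    ultimately show ?thesis by simp
  qed
  ultimately show ?thesis
    unfolding bialgebra_ideal_def tensor_ideal_def by blast
qed

section \<open>The Galois map and the antipode\<close>

lemma finite_dimensional_tensor:
  assumes "finite_dimensional TYPE('a::complex_vector)" "finite_dimensional TYPE('b::complex_vector)"
  shows "finite_dimensional TYPE(('a, 'b) tensor)"
proof -
  obtain A :: "'a set" and B :: "'b set"
    where A: "finite A" "complex_vector.span A = UNIV" and B: "finite B" "complex_vector.span B = UNIV"
    using assms unfolding finite_dimensional_def by blast
  let ?S = "complex_vector.span ((\<lambda>(a, b). a \<otimes>\<^sub>C b) ` (A \<times> B))"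
  \<comment> \<open>Linear extension proceeds one factor at a time, first on the right.\<close>
  have 1: "a \<otimes>\<^sub>C b \<in> ?S" if "a \<in> A" for a b
    by (rule clinear_span_subset[OF clinear_tensor_right, of _ B])
      (use that B in \<open>auto intro: complex_vector.span_base\<close>)
  have 2: "a \<otimes>\<^sub>C b \<in> ?S" for a b
    by (rule clinear_span_subset[OF clinear_tensor_left, of _ A]) (use A 1 in auto)
  have "t \<in> ?S" for t
    by (induction t rule: tensor_induct) (auto intro: 2 complex_vector.span_add)
  then show ?thesis
    unfolding finite_dimensional_def using A(1) B(1)
    by (intro exI[of _ "(\<lambda>(a, b). a \<otimes>\<^sub>C b) ` (A \<times> B)"]) auto
qed

text \<open>An injective linear map preserves dimension, so the image of \<open>M\<close> is a
  subspace of \<open>M\<close> of full dimension.\<close>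

lemma injective_image_eq_subspace:
  fixes f :: "'a::complex_vector \<Rightarrow> 'a"
  assumes fin: "finite_dimensional TYPE('a)" and f: "clinear f" "inj f"
    and M: "complex_vector.subspace M" "f ` M \<subseteq> M"
  shows "f ` M = M"
proof -
  obtain B :: "'a set" where B: "finite B" "complex_vector.span B = UNIV"
    using fin unfolding finite_dimensional_def by blast
  obtain C where C: "C \<subseteq> B" "complex_vector.independent C" "complex_vector.span C = UNIV"
    using complex_vector.maximal_independent_subset[of B] B
    by (metis complex_vector.span_mono complex_vector.span_span top.extremum_uniqueI)
  interpret fd: finite_dimensional_vector_space "scaleC :: complex \<Rightarrow> 'a \<Rightarrow> 'a" C
    by unfold_locales (use C B finite_subset in auto)
  interpret p: finite_dimensional_vector_space_pair "scaleC :: complex \<Rightarrow> 'a \<Rightarrow> 'a" C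
    "scaleC :: complex \<Rightarrow> 'a \<Rightarrow> 'a" C
    by unfold_locales
  have "complex_vector.dim (f ` M) = complex_vector.dim M"
    by (rule p.dim_image_eq[OF f(1)]) (use f(2) in \<open>auto intro: inj_on_subset\<close>)
  then show ?thesis
    using M by (intro fd.subspace_dim_equal module_hom.subspace_image[OF module_hom_linearI[OF f(1)]]) auto
qed

context hopf_algebra
begin

text \<open>The canonical map of H as a Hopf-Galois extension of the complex numbers.\<close>

definition galois :: "('h, 'h) tensor \<Rightarrow> ('h, 'h) tensor" where
  "galois = tensor_lift (\<lambda>a b. tensor_lift (\<lambda>x y. (a * x) \<otimes>\<^sub>C y) (comult b))"

definition galois_inverse :: "('h, 'h) tensor \<Rightarrow> ('h, 'h) tensor" where
  "galois_inverse = tensor_lift (\<lambda>a b. tensor_lift (\<lambda>x y. (a * antipode x) \<otimes>\<^sub>C y) (comult b))"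

text \<open>Here and in the next lemma, \<open>f\<close> is the identity for \<open>galois\<close>
  and \<open>antipode\<close> for \<open>galois_inverse\<close>.\<close>

lemma cbilinear_mult_tensor:
  assumes "clinear f"
  shows "cbilinear (\<lambda>x (y::'h). ((a::'h) * f x) \<otimes>\<^sub>C y)"
  by (intro cbilinearI clinear_tensor_right clinear_compose[OF clinear_tensor_left]
      clinear_compose[OF clinear_mult_left] assms)

lemma cbilinear_mult_comult:
  assumes "clinear f"
  shows "cbilinear (\<lambda>a b. tensor_lift (\<lambda>x y. ((a::'h) * f x) \<otimes>\<^sub>C (y::'h)) (comult b))"
  by (intro cbilinear_tensor_lift cbilinear_mult_tensor assms comult_linear
      clinear_compose[OF clinear_tensor_left] clinear_mult_right)

lemma clinear_galois: "clinear galois"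
  and galois_tensor: "galois (a \<otimes>\<^sub>C b) = tensor_lift (\<lambda>x y. (a * x) \<otimes>\<^sub>C y) (comult b)"
proof -
  have id: "clinear (\<lambda>x::'h. x)" by (rule clinearI) simp_all
  note * = cbilinear_mult_comult[OF id]
  show "clinear galois" unfolding galois_def by (rule clinear_tensor_lift[OF *])
  show "galois (a \<otimes>\<^sub>C b) = tensor_lift (\<lambda>x y. (a * x) \<otimes>\<^sub>C y) (comult b)"
    unfolding galois_def by (rule tensor_lift_tensor[OF *])
qed

lemma clinear_galois_inverse: "clinear galois_inverse"
  and galois_inverse_tensor:
    "galois_inverse (a \<otimes>\<^sub>C b) = tensor_lift (\<lambda>x y. (a * antipode x) \<otimes>\<^sub>C y) (comult b)"
  unfolding galois_inverse_def
  by (intro clinear_tensor_lift tensor_lift_tensor cbilinear_mult_comult antipode_linear)+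

text \<open>In Sweedler notation the composite sends \<open>a \<otimes> b\<close> to the sum of
  \<open>a b\<^sub>1 S(b\<^sub>2) \<otimes> b\<^sub>3\<close>. After coassociativity,
  \<open>antipode_right\<close> collapses the first two parts of \<open>b\<close> to a counit, which
  \<open>counit_left\<close> removes.\<close>

lemma galois_inverse_galois: "galois_inverse (galois t) = t"
proof (rule clinear_eq_on_tensors[of "\<lambda>t. galois_inverse (galois t)" "\<lambda>t. t"])
  show "clinear (\<lambda>t. galois_inverse (galois t))"
    by (rule clinear_compose[OF clinear_galois_inverse clinear_galois])
  show "clinear (\<lambda>t::('h, 'h) tensor. t)" by (rule clinearI) simp_all
  fix a b :: 'h
  have id: "clinear (\<lambda>x::'h. x)" "clinear (id :: 'h \<Rightarrow> 'h)" by (rule clinearI; simp)+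
  \<comment> \<open>\<open>\<psi>\<close> carries all that happens after the iterated coproduct of
    \<open>b\<close>, so that \<open>coassoc\<close> can be applied to its argument.\<close>
  define \<psi> :: "('h, ('h, 'h) tensor) tensor \<Rightarrow> ('h, 'h) tensor" where
    "\<psi> = tensor_lift (\<lambda>x s. tensor_lift (\<lambda>y z. (a * x * antipode y) \<otimes>\<^sub>C z) s)"
  have b\<psi>: "cbilinear (\<lambda>x s. tensor_lift (\<lambda>y z. (a * x * antipode y) \<otimes>\<^sub>C (z::'h)) s)"
    by (intro cbilinear_tensor_lift cbilinear_mult_tensor antipode_linear
        clinear_compose[OF clinear_tensor_left] clinear_compose[OF clinear_mult_right]
        clinear_mult_left) (rule clinearI; simp)
  have \<psi>: "clinear \<psi>" unfolding \<psi>_def by (rule clinear_tensor_lift[OF b\<psi>])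
  have \<psi>_tensor: "\<psi> (x \<otimes>\<^sub>C s) = tensor_lift (\<lambda>y z. (a * x * antipode y) \<otimes>\<^sub>C z) s" for x s
    unfolding \<psi>_def by (rule tensor_lift_tensor[OF b\<psi>])
  have bl: "cbilinear (\<lambda>x y. counit x *\<^sub>C (y::'h))"
    by (intro cbilinearI clinear_functional_scale counit_linear clinear_scaleC)
  have "galois_inverse (galois (a \<otimes>\<^sub>C b)) = tensor_lift (\<lambda>x y. galois_inverse ((a * x) \<otimes>\<^sub>C y)) (comult b)"
    unfolding galois_tensor
    by (rule clinear_comp_tensor_lift[OF clinear_galois_inverse cbilinear_mult_tensor[OF id(1)]])
  \<comment> \<open>Inserting \<open>id\<close> exposes the form
    \<open>map_tensor id comult\<close>, one side of \<open>coassoc\<close>.\<close>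
  also have "\<dots> = tensor_lift (\<lambda>x y. \<psi> (id x \<otimes>\<^sub>C comult y)) (comult b)"
    by (simp add: \<psi>_tensor galois_inverse_tensor)
  also have "\<dots> = \<psi> (map_tensor id comult (comult b))"
    unfolding map_tensor_def
    by (rule clinear_comp_tensor_lift[OF \<psi>, symmetric])
      (intro cbilinearI clinear_compose[OF clinear_tensor_left]
        clinear_compose[OF clinear_tensor_right] comult_linear id)
  also have "\<dots> = \<psi> (tensor_assoc (map_tensor comult id (comult b)))"
    by (simp add: coassoc)
  \<comment> \<open>Both sides are linear in \<open>comult b\<close>, which may thus be replaced by
    \<open>x \<otimes>\<^sub>C y\<close>. Now \<open>x\<close> is the factor that gets split, and
    its two parts meet in \<open>antipode_right\<close>.\<close>
  also have "\<dots> = a \<otimes>\<^sub>C tensor_lift (\<lambda>x y. counit x *\<^sub>C y) (comult b)"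
  proof (rule clinear_eq_on_tensors[where f = "\<lambda>t. \<psi> (tensor_assoc (map_tensor comult id t))"
        and g = "\<lambda>t. a \<otimes>\<^sub>C tensor_lift (\<lambda>x y. counit x *\<^sub>C y) t"])
    show "clinear (\<lambda>t. \<psi> (tensor_assoc (map_tensor comult id t)))"
      by (intro clinear_compose[OF \<psi>] clinear_compose[OF clinear_tensor_assoc]
          clinear_map_tensor comult_linear id)
    show "clinear (\<lambda>t. a \<otimes>\<^sub>C tensor_lift (\<lambda>x y. counit x *\<^sub>C (y::'h)) t)"
      by (intro clinear_compose[OF clinear_tensor_right] clinear_tensor_lift bl)
    fix x y :: 'h
    have m: "cbilinear (\<lambda>p q. p * antipode q)"
      by (intro cbilinearI clinear_mult_right clinear_compose[OF clinear_mult_left] antipode_linear)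
    have "\<psi> (tensor_assoc (map_tensor comult id (x \<otimes>\<^sub>C y))) = \<psi> (tensor_assoc (comult x \<otimes>\<^sub>C y))"
      by (simp add: map_tensor_tensor comult_linear id)
    \<comment> \<open>Likewise \<open>comult x\<close> is replaced by an arbitrary
      \<open>s\<close>.\<close>
    also have "\<dots> = (a * tensor_lift (\<lambda>p q. p * antipode q) (comult x)) \<otimes>\<^sub>C y"
    proof (rule clinear_eq_on_tensors[where f = "\<lambda>s. \<psi> (tensor_assoc (s \<otimes>\<^sub>C y))"
          and g = "\<lambda>s. (a * tensor_lift (\<lambda>p q. p * antipode q) s) \<otimes>\<^sub>C y"])
      show "clinear (\<lambda>s. \<psi> (tensor_assoc (s \<otimes>\<^sub>C y)))"
        by (intro clinear_compose[OF \<psi>] clinear_compose[OF clinear_tensor_assoc] clinear_tensor_left)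
      show "clinear (\<lambda>s. (a * tensor_lift (\<lambda>p q. p * antipode q) s) \<otimes>\<^sub>C y)"
        by (intro clinear_compose[OF clinear_tensor_left] clinear_compose[OF clinear_mult_left]
            clinear_tensor_lift m)
      show "\<psi> (tensor_assoc ((p \<otimes>\<^sub>C q) \<otimes>\<^sub>C y))
          = (a * tensor_lift (\<lambda>p q. p * antipode q) (p \<otimes>\<^sub>C q)) \<otimes>\<^sub>C y" for p q
        by (simp add: tensor_assoc_tensor \<psi>_tensor tensor_lift_tensor[OF m] mult.assoc
            tensor_lift_tensor[OF cbilinear_mult_tensor[OF antipode_linear, of "a * p", unfolded mult.assoc]])
    qed
    also have "\<dots> = a \<otimes>\<^sub>C tensor_lift (\<lambda>x y. counit x *\<^sub>C y) (x \<otimes>\<^sub>C y)"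
      by (simp add: antipode_right tensor_lift_tensor[OF bl] mult_scaleC_right
          tensor_scale_left tensor_scale_right)
    finally show "\<psi> (tensor_assoc (map_tensor comult id (x \<otimes>\<^sub>C y)))
        = a \<otimes>\<^sub>C tensor_lift (\<lambda>x y. counit x *\<^sub>C y) (x \<otimes>\<^sub>C y)" .
  qed
  also have "\<dots> = a \<otimes>\<^sub>C b" by (simp add: counit_left)
  finally show "galois_inverse (galois (a \<otimes>\<^sub>C b)) = a \<otimes>\<^sub>C b" .
qed

text \<open>For \<open>a\<close> in \<open>K\<close> all left factors \<open>a * x\<close> lie in
  \<open>K\<close>. For \<open>b\<close> in \<open>K\<close> the coproduct is already in the tensor
  ideal, and multiplying left factors by \<open>a\<close> keeps it there.\<close>

lemma galois_preserves_tensor_ideal: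
  assumes "bialgebra_ideal comult counit K" "t \<in> tensor_ideal K"
  shows "galois t \<in> tensor_ideal K"
  using assms(2)
proof (rule clinear_tensor_ideal_subset[OF clinear_galois subspace_tensor_ideal, rotated])
  have K: "two_sided_ideal K" "\<And>h. h \<in> K \<Longrightarrow> comult h \<in> tensor_ideal K"
    using assms(1) unfolding bialgebra_ideal_def tensor_ideal_def by blast+
  fix a b assume ab: "a \<in> K \<or> b \<in> K"
  have id: "clinear (\<lambda>x::'h. x)" by (rule clinearI) simp_all
  have bil: "cbilinear (\<lambda>x y. (a * x) \<otimes>\<^sub>C (y::'h))"
    by (rule cbilinear_mult_tensor[OF id])
  from ab show "galois (a \<otimes>\<^sub>C b) \<in> tensor_ideal K"
  proof
    assume a: "a \<in> K"
    have "tensor_lift (\<lambda>x y. (a * x) \<otimes>\<^sub>C y) s \<in> tensor_ideal K" for s :: "('h, 'h) tensor"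
    proof (induction s rule: tensor_induct)
      case (tensor x y)
      have "a * x \<in> K" using a K(1) by (simp add: two_sided_ideal_def)
      then show ?case by (simp add: tensor_lift_tensor[OF bil] tensor_in_tensor_ideal)
    next
      case (add s t)
      then show ?case
        by (simp add: clinear_add[OF clinear_tensor_lift[OF bil]]
            complex_vector.subspace_add[OF subspace_tensor_ideal])
    qed
    then show ?thesis by (simp add: galois_tensor)
  next
    assume b: "b \<in> K"
    show ?thesis
      unfolding galois_tensor
      by (rule clinear_tensor_ideal_subset[OF clinear_tensor_lift[OF bil] subspace_tensor_ideal _ K(2)[OF b]])
        (use K(1) in \<open>auto simp: tensor_lift_tensor[OF bil] two_sided_ideal_def intro: tensor_in_tensor_ideal\<close>)
  qed
qed

text \<open>Finite dimension turns injectivity of \<open>galois\<close> on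
  \<open>tensor_ideal K\<close> into surjectivity onto it, so its left inverse preserves
  \<open>tensor_ideal K\<close> as well.\<close>

lemma bialgebra_ideal_imp_hopf_ideal:
  assumes K: "bialgebra_ideal comult counit K" and fin: "finite_dimensional TYPE('h)"
  shows "hopf_ideal comult counit antipode K"
proof -
  let ?M = "tensor_ideal K"
  have sub: "complex_vector.subspace K" and cK: "\<And>h. h \<in> K \<Longrightarrow> counit h = 0"
    using K unfolding bialgebra_ideal_def two_sided_ideal_def by auto
  have "inj galois"
    by (rule inj_on_inverseI[of _ galois_inverse]) (rule galois_inverse_galois)
  then have M: "galois ` ?M = ?M"
    using galois_preserves_tensor_ideal[OF K]
    by (intro injective_image_eq_subspace finite_dimensional_tensor fin clinear_galois
        subspace_tensor_ideal) auto
  have b: "cbilinear (\<lambda>x y. counit y *\<^sub>C (x::'h))"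
    by (intro cbilinearI clinear_functional_scale counit_linear clinear_scaleC)
  have "antipode k \<in> K" if k: "k \<in> K" for k
  proof -
    have "1 \<otimes>\<^sub>C k \<in> galois ` ?M"
      unfolding M using k by (simp add: tensor_in_tensor_ideal)
    then have "galois_inverse (1 \<otimes>\<^sub>C k) \<in> ?M"
      by (auto simp: galois_inverse_galois)
    \<comment> \<open>Applying \<open>counit\<close> to the right factor maps \<open>?M\<close> into
      \<open>K\<close>: right factors in \<open>K\<close> are killed, and left factors in
      \<open>K\<close> are only rescaled.\<close>
    then have "tensor_lift (\<lambda>x y. counit y *\<^sub>C x) (galois_inverse (1 \<otimes>\<^sub>C k)) \<in> K"
      by (rule clinear_tensor_ideal_subset[OF clinear_tensor_lift[OF b] sub, rotated])
        (auto simp: tensor_lift_tensor[OF b] cK complex_vector.subspace_scale[OF sub]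
          complex_vector.subspace_0[OF sub])
    also have "tensor_lift (\<lambda>x y. counit y *\<^sub>C x) (galois_inverse (1 \<otimes>\<^sub>C k))
        = tensor_lift (\<lambda>x y. counit y *\<^sub>C antipode x) (comult k)"
      unfolding galois_inverse_tensor
        clinear_comp_tensor_lift[OF clinear_tensor_lift[OF b] cbilinear_mult_tensor[OF antipode_linear]]
      by (simp add: tensor_lift_tensor[OF b])
    also have "\<dots> = antipode (tensor_lift (\<lambda>x y. counit y *\<^sub>C x) (comult k))"
      by (simp add: clinear_comp_tensor_lift[OF antipode_linear b] clinear_scale[OF antipode_linear])
    also have "\<dots> = antipode k" by (simp add: counit_right)
    finally show ?thesis .
  qed
  then show ?thesis
    using K unfolding hopf_ideal_def by blast
qed

end

theorem theorem5p9:
  fixes comult :: "'h::complex_algebra_1 \<Rightarrow> ('h, 'h) tensor"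
    and counit :: "'h \<Rightarrow> complex"
    and antipode :: "'h \<Rightarrow> 'h"
    and vac :: "'v::complex_vector"
    and Y :: "'v \<Rightarrow> int \<Rightarrow> 'v \<Rightarrow> 'v"
    and act :: "'h \<Rightarrow> 'v \<Rightarrow> 'v"
  assumes "hopf_algebra comult counit antipode"
    and "module_vertex_algebra comult counit antipode vac Y act"
    and nonzero: "\<exists>v::'v. v \<noteq> 0"
    and "inj (pi2 Y)"
  shows "bialgebra_ideal comult counit (action_kernel act) \<and>
    (finite_dimensional TYPE('h) \<longrightarrow>
       hopf_ideal comult counit antipode (action_kernel act))"
  using module_vertex_algebra.bialgebra_ideal_action_kernel[OF assms(2,3,4)]
    hopf_algebra.bialgebra_ideal_imp_hopf_ideal[OF assms(1)]
  by blast

end
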